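(* Let $1\le k\le n$. The number of frustrated parking functions of length $n$ whose set of positions of lucky cars is $[k]$, and the number of frustrated parking functions of length $n$ whose set of lucky spots is $[k]$, are both equal to $k!\,S(n,k)$. That is, $|LC^n_{[k]}| = |LS^n_{[k]}| = k!\,S(n,k)$.
   Context: Let $n\ge 1$ and $[m]=\{1,2,\dots,m\}$. There are $n$ cars and $n$ parking spots numbered $1,\dots,n$, all initially empty. Given a preference sequence $(a_1,\dots,a_n)\in[n]^n$, cars $1,2,\dots,n$ enter in this order. If spot $a_i$ is unoccupied when car $i$ enters, car $i$ parks in spot $a_i$. Otherwise car $i$ parks in the largest-numbered unoccupied spot greater than $a_i$, if such a spot exists; if none exists, car $i$ cannot park. The sequence $(a_1,\dots,a_n)$ is a frustrated parking function of length $n$ if all $n$ cars can park under this rule. For a frustrated parking function, car $j$ is lucky if it parks in its preferred spot $a_j$, and unlucky otherwise; a spot is lucky if the car that parks in it is lucky, and unlucky otherwise. For $T\subseteq[n]$, $LS^n_T$ is the set of frustrated parking functions of length $n$ whose set of lucky spots is exactly $T$, and $LC^n_T$ is the set of frustrated parking functions of length $n$ whose set of positions (indices $j$) of lucky cars is exactly $T$. $S(n,k)$ is the Stirling number of the second kind, the number of set partitions of $[n]$ into $k$ blocks. *)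

theory Defs
  imports Main "HOL-Library.Disjoint_Sets"
begin

text \<open>
  A preference sequence \<open>(a\<^sub>1, \<dots>, a\<^sub>n)\<close> is the list \<open>as = [a\<^sub>1, \<dots>, a\<^sub>n]\<close>. Spots are the
  numbers \<open>1, \<dots>, n\<close>. Cars are numbered from 1 as well, so the preference of car \<open>j\<close> is
  \<open>as ! (j - 1)\<close>.
\<close>

definition parking_spot :: "nat \<Rightarrow> nat set \<Rightarrow> nat \<Rightarrow> nat option" where
  "parking_spot n occ p =
     (if p \<notin> occ then Some p
      else let free = {p<..n} - occ
           in if free = {} then None else Some (Max free))"

text \<open>
  The \<open>j\<close>-th entry of the result is \<open>Some s\<close> if the \<open>j\<close>-th car of the list parks in spot \<open>s\<close>,
  and \<open>None\<close> if it cannot park; \<open>occ\<close> is the set of spots occupied before the first of them enters.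
\<close>

fun park :: "nat \<Rightarrow> nat set \<Rightarrow> nat list \<Rightarrow> nat option list" where
  "park n occ [] = []"
| "park n occ (a # as) =
     (case parking_spot n occ a of
        None \<Rightarrow> None # park n occ as
      | Some s \<Rightarrow> Some s # park n (insert s occ) as)"

definition spot_of_car :: "nat \<Rightarrow> nat list \<Rightarrow> nat \<Rightarrow> nat option" where
  "spot_of_car n as j = park n {} as ! (j - 1)"

definition frustrated_parking_function :: "nat \<Rightarrow> nat list \<Rightarrow> bool" where
  "frustrated_parking_function n as \<longleftrightarrow>
     length as = n \<and> set as \<subseteq> {1..n} \<and> (\<forall>j\<in>{1..n}. spot_of_car n as j \<noteq> None)"

definition lucky_cars :: "nat \<Rightarrow> nat list \<Rightarrow> nat set" where
  "lucky_cars n as = {j \<in> {1..n}. spot_of_car n as j = Some (as ! (j - 1))}"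

definition lucky_spots :: "nat \<Rightarrow> nat list \<Rightarrow> nat set" where
  "lucky_spots n as = {s \<in> {1..n}. \<exists>j \<in> lucky_cars n as. spot_of_car n as j = Some s}"

definition LC :: "nat \<Rightarrow> nat set \<Rightarrow> nat list set" where
  "LC n T = {as. frustrated_parking_function n as \<and> lucky_cars n as = T}"

definition LS :: "nat \<Rightarrow> nat set \<Rightarrow> nat list set" where
  "LS n T = {as. frustrated_parking_function n as \<and> lucky_spots n as = T}"

text \<open>
  Stirling numbers of the second kind, defined by counting set partitions. The library constant
  \<open>Stirling\<close> in \<open>HOL-Combinatorics\<close> is instead defined by the recurrence.
\<close>

definition stirling2 :: "nat \<Rightarrow> nat \<Rightarrow> nat" where
  "stirling2 n k = card {P. partition_on {1..n} P \<and> card P = k}"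

end

theory Submission
  imports Defs "HOL-Combinatorics.Multiset_Permutations"
begin

text \<open>
  Both families are in bijection with the words \<open>w\<close> of length \<open>n\<close> whose set of letters is
  \<open>{1..k}\<close>, that is, with the surjections from \<open>{1..n}\<close> onto \<open>{1..k}\<close>. Such a surjection
  amounts to a partition of \<open>{1..n}\<close> into \<open>k\<close> fibres together with a linear order on the fibres,
  so there are \<open>k! S(n, k)\<close> of them (\<open>card_surjective_words\<close>).

  The observation that makes both bijections work: when all cars park, an unlucky car takes the
  largest free spot, so every spot beyond it is full. Consequently the spot that an unlucky car
  prefers cannot have been filled by another unlucky car: at that moment, the spot that the later
  car is going to take was still free and larger. Every preference is therefore a lucky spot
  (\<open>preference_in_lucky\<close>), and the set of lucky spots is simply the set of preferences.

  Lucky spots \<open>{1..k}\<close>: the preference sequence is then itself a surjective word. Conversely, for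
  every surjective word the cars repeating an earlier letter fill the spots \<open>n, n - 1, \<dots>, k + 1\<close>
  in this order and never get in the way of the first occurrences of letters, which are at most
  \<open>k\<close>. So \<open>LS\<close> is the set of surjective words (\<open>LS_eq_surjective_words\<close>).

  Lucky cars \<open>{1..k}\<close>: label each spot \<open>p\<close> with the lucky car that occupies the spot preferred by
  the car parked at \<open>p\<close>. This is a surjective word in which the spot of the lucky car \<open>j\<close> is the
  first occurrence of the letter \<open>j\<close>, because every car parks at or beyond its preference. The word
  determines the sequence: its first occurrences are the spots of the cars \<open>1, \<dots>, k\<close>, the other
  spots are filled in descending order by the remaining cars, and the car at \<open>p\<close> prefers the first
  occurrence of the letter at \<open>p\<close> (\<open>bij_betw_prefs_of_word\<close>).
\<close>

section \<open>Outcomes of the parking process\<close>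

lemma parking_spot_eq_Some_iff:
  "parking_spot n occ p = Some s \<longleftrightarrow>
     (p \<notin> occ \<and> s = p) \<or>
     (p \<in> occ \<and> p < s \<and> s \<le> n \<and> s \<notin> occ \<and> {s<..n} \<subseteq> occ)"
proof (cases "p \<in> occ")
  case True
  let ?free = "{p<..n} - occ"
  have "?free \<noteq> {} \<and> Max ?free = s \<longleftrightarrow> s \<in> ?free \<and> (\<forall>x\<in>?free. x \<le> s)"
  proof (cases "?free = {}")
    case False
    then show ?thesis using Max_eq_iff[of ?free s] by blast
  qed auto
  also have "\<dots> \<longleftrightarrow> p < s \<and> s \<le> n \<and> s \<notin> occ \<and> (\<forall>x. s < x \<and> x \<le> n \<longrightarrow> x \<in> occ)"
    by (metis DiffE DiffI greaterThanAtMost_iff not_le order_less_trans)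
  also have "(\<forall>x. s < x \<and> x \<le> n \<longrightarrow> x \<in> occ) \<longleftrightarrow> {s<..n} \<subseteq> occ"
    by auto
  finally show ?thesis
    using True by (auto simp: parking_spot_def Let_def)
qed (auto simp: parking_spot_def)

text \<open>
  This replaces the recursion, which threads the set of occupied spots, by one independent condition
  per car: the spots occupied when a car enters can be read off from the list of final positions.
\<close>

lemma park_eq_map_Some_iff:
  "park n occ as = map Some ss \<longleftrightarrow>
     length ss = length as \<and>
     (\<forall>i<length as. parking_spot n (occ \<union> set (take i ss)) (as ! i) = Some (ss ! i))"
proof (induction as arbitrary: occ ss)
  case (Cons a as)
  show ?case
  proof (cases ss)
    case (Cons s ss')
    have "(\<forall>i<Suc (length as).
          parking_spot n (occ \<union> set (take i ss)) ((a # as) ! i) = Some (ss ! i)) \<longleftrightarrow>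
        parking_spot n occ a = Some s \<and>
        (\<forall>i<length as. parking_spot n (insert s occ \<union> set (take i ss')) (as ! i) = Some (ss' ! i))"
      unfolding Cons All_less_Suc2 by simp
    then show ?thesis
      unfolding Cons by (auto simp: Cons.IH split: option.split)
  qed (auto split: option.split)
qed auto

text \<open>
  Here \<open>ss ! i\<close> is the spot of car \<open>i + 1\<close>. That each spot is free when it is taken is encoded in
  the equations \<open>length ss = n\<close> and \<open>set ss = {1..n}\<close>, which force \<open>ss\<close> to be free of repetitions.
  The second disjunct is the unlucky case; its last conjunct says that the spot taken is the largest
  free one.
\<close>

definition outcome :: "nat \<Rightarrow> nat list \<Rightarrow> nat list \<Rightarrow> bool" where
  "outcome n as ss \<longleftrightarrow>
     length as = n \<and> length ss = n \<and> set ss = {1..n} \<and>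
     (\<forall>i<n. as ! i = ss ! i \<or>
        as ! i \<in> set (take i ss) \<and> as ! i < ss ! i \<and> {ss ! i<..n} \<subseteq> set (take i ss))"

lemma outcome_distinct: "outcome n as ss \<Longrightarrow> distinct ss"
  by (auto simp: outcome_def intro: card_distinct)

lemma not_in_take: "distinct xs \<Longrightarrow> i < length xs \<Longrightarrow> xs ! i \<notin> set (take i xs)"
  by (auto simp: in_set_conv_nth nth_eq_iff_index_eq)

text \<open>
  When every car parks, the \<open>n\<close> spots taken are distinct and lie in \<open>{1..n}\<close>, so by counting they
  are all of \<open>{1..n}\<close>. In the other direction, the preferences are in range because each of them is
  the spot of some car.
\<close>

lemma park_eq_iff_outcome:
  assumes "length as = n"
  shows "set as \<subseteq> {1..n} \<and> park n {} as = map Some ss \<longleftrightarrow> outcome n as ss"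
proof
  assume L: "set as \<subseteq> {1..n} \<and> park n {} as = map Some ss"
  then have len: "length ss = n"
    and spot: "\<And>i. i < n \<Longrightarrow> parking_spot n (set (take i ss)) (as ! i) = Some (ss ! i)"
    using assms by (auto simp: park_eq_map_Some_iff)
  have pref: "as ! i \<in> {1..n}" if "i < n" for i
    using L assms that nth_mem by blast
  have new: "ss ! i \<notin> set (take i ss)" and range: "ss ! i \<in> {1..n}" if "i < n" for i
    using spot[OF that] pref[OF that] by (auto simp: parking_spot_eq_Some_iff)
  have "ss ! i \<noteq> ss ! j" if "i < j" "j < n" for i j
    using new[of j] that len by (auto simp: in_set_conv_nth)
  then have dist: "distinct ss"
    using len by (auto simp: distinct_conv_nth) (metis linorder_neqE_nat)
  have "set ss \<subseteq> {1..n}"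
    using range len by (auto simp: in_set_conv_nth)
  with dist len have "set ss = {1..n}"
    by (intro card_subset_eq) (auto simp: distinct_card)
  then show "outcome n as ss"
    using assms len spot by (fastforce simp: outcome_def parking_spot_eq_Some_iff)
next
  assume R: "outcome n as ss"
  note dist = outcome_distinct[OF R]
  have range: "ss ! i \<in> {1..n}" if "i < n" for i
    using R nth_mem[of i ss] that by (auto simp: outcome_def)
  have "parking_spot n (set (take i ss)) (as ! i) = Some (ss ! i)" if "i < n" for i
    using R that dist not_in_take[OF dist, of i] range[of i]
    by (auto simp: outcome_def parking_spot_eq_Some_iff)
  moreover have "as ! i \<in> {1..n}" if "i < n" for i
  proof -
    have "as ! i = ss ! i \<or> as ! i \<in> set (take i ss)"
      using R that by (auto simp: outcome_def)
    then show ?thesis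
      using R range[OF that] set_take_subset[of i ss] by (auto simp: outcome_def)
  qed
  ultimately show "set as \<subseteq> {1..n} \<and> park n {} as = map Some ss"
    using R by (auto simp: outcome_def park_eq_map_Some_iff in_set_conv_nth)
qed

lemma length_park [simp]: "length (park n occ as) = length as"
  by (induction n occ as rule: park.induct) (auto split: option.split)

lemma frustrated_iff_outcome: "frustrated_parking_function n as \<longleftrightarrow> (\<exists>ss. outcome n as ss)"
proof
  assume F: "frustrated_parking_function n as"
  have "park n {} as ! i \<noteq> None" if "i < n" for i
    using F that by (force simp: frustrated_parking_function_def spot_of_car_def dest!: bspec[of _ _ "Suc i"])
  then have "park n {} as = map Some (map the (park n {} as))"
    using F by (auto simp: frustrated_parking_function_def intro!: nth_equalityI)
  then show "\<exists>ss. outcome n as ss"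
    using F park_eq_iff_outcome by (metis frustrated_parking_function_def)
next
  assume "\<exists>ss. outcome n as ss"
  then obtain ss where ss: "outcome n as ss" ..
  then have len: "length as = n" by (simp add: outcome_def)
  with ss have "set as \<subseteq> {1..n}" "park n {} as = map Some ss" "length ss = n"
    using park_eq_iff_outcome[OF len, of ss] by (simp_all add: outcome_def)
  then show "frustrated_parking_function n as"
    using len by (auto simp: frustrated_parking_function_def spot_of_car_def)
qed

lemma outcome_unique: "outcome n as ss \<Longrightarrow> outcome n as ss' \<Longrightarrow> ss = ss'"
  by (metis park_eq_iff_outcome outcome_def inj_map_eq_map inj_Some)

lemma spot_of_car_outcome:
  assumes "outcome n as ss" "j \<in> {1..n}"
  shows "spot_of_car n as j = Some (ss ! (j - 1))"
proof -
  have "park n {} as = map Some ss" "length ss = n"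
    using assms park_eq_iff_outcome[of as n ss] by (simp_all add: outcome_def)
  then show ?thesis
    using assms by (auto simp: spot_of_car_def)
qed

lemma lucky_cars_outcome:
  "outcome n as ss \<Longrightarrow> lucky_cars n as = {j \<in> {1..n}. as ! (j - 1) = ss ! (j - 1)}"
  by (auto simp: lucky_cars_def spot_of_car_outcome)

text \<open>
  An unlucky car finds its preferred spot taken by an earlier car. If that one were unlucky as well,
  all spots beyond the one it took would have been full already, including the larger spot that is
  still to be taken.
\<close>

lemma preference_in_lucky:
  assumes "outcome n as ss" "i < n"
  shows "\<exists>j\<le>i. as ! j = ss ! j \<and> as ! i = ss ! j"
proof (cases "as ! i = ss ! i")
  case False
  with assms have i: "as ! i \<in> set (take i ss)" "as ! i < ss ! i"
    by (auto simp: outcome_def)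
  then obtain j where j: "j < i" "as ! i = ss ! j"
    using assms by (auto simp: in_set_conv_nth outcome_def)
  have "as ! j = ss ! j"
  proof (rule ccontr)
    assume "as ! j \<noteq> ss ! j"
    moreover have "j < n" using j assms by simp
    ultimately have "{ss ! j<..n} \<subseteq> set (take j ss)"
      using assms(1) unfolding outcome_def by blast
    moreover have "ss ! i \<le> n"
      using assms nth_mem[of i ss] by (auto simp: outcome_def)
    ultimately have "ss ! i \<in> set (take j ss)"
      using i j by auto
    moreover have "set (take j ss) \<subseteq> set (take i ss)"
      using j by (simp add: set_take_subset_set_take)
    ultimately show False
      using not_in_take[of ss i] outcome_distinct[OF assms(1)] assms by (auto simp: outcome_def)
  qed
  with j show ?thesis by (metis less_imp_le)
qed auto

lemma lucky_spots_outcome: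
  assumes "outcome n as ss"
  shows "lucky_spots n as = set as"
proof
  have len: "length as = n" using assms by (simp add: outcome_def)
  show "lucky_spots n as \<subseteq> set as"
  proof
    fix s assume "s \<in> lucky_spots n as"
    then obtain j where "j \<in> {1..n}" "as ! (j - 1) = s"
      using assms by (auto simp: lucky_spots_def lucky_cars_def spot_of_car_outcome)
    with len show "s \<in> set as" by (auto intro!: nth_mem)
  qed
  show "set as \<subseteq> lucky_spots n as"
  proof
    fix s assume "s \<in> set as"
    then obtain i where i: "i < n" "s = as ! i"
      using len by (auto simp: in_set_conv_nth)
    then obtain j where j: "j \<le> i" "as ! j = ss ! j" "s = ss ! j"
      using preference_in_lucky[OF assms] by blast
    then have "s \<in> {1..n}" using assms i nth_mem[of j ss] by (auto simp: outcome_def)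
    moreover have "Suc j \<in> {1..n}" using j i by auto
    ultimately show "s \<in> lucky_spots n as"
      using j assms
      by (auto simp: lucky_spots_def lucky_cars_outcome spot_of_car_outcome intro!: bexI[of _ "Suc j"])
  qed
qed

section \<open>Lucky spots and surjective words\<close>

definition surjective_words :: "nat \<Rightarrow> nat \<Rightarrow> nat list set" where
  "surjective_words n k = {w. length w = n \<and> set w = {1..k}}"

text \<open>
  Before car \<open>i + 1\<close> enters, \<open>seen i\<close> is the set of letters used so far and \<open>rep i\<close> the number of
  cars that repeated a letter. The invariant (\<open>taken\<close> below) is that the occupied spots are the
  letters seen and the top \<open>rep i\<close> spots. There are \<open>n - k\<close> repetitions in total, so the top block
  never reaches the spots \<open>{1..k}\<close>.
\<close>

lemma surjective_word_outcome:
  assumes w: "w \<in> surjective_words n k"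
  shows "\<exists>ss. outcome n w ss"
proof -
  have len: "length w = n" and set: "set w = {1..k}"
    using w by (auto simp: surjective_words_def)
  define seen where "seen = (\<lambda>i. set (take i w))"
  define rep where "rep = (\<lambda>i. i - card (seen i))"
  define ss where "ss = map (\<lambda>i. if w ! i \<in> seen i then n - rep i else w ! i) [0..<n]"
  have card_le: "card (seen i) \<le> i" for i
    unfolding seen_def by (metis card_length length_take min.cobounded2 order_trans)
  have seen_Suc: "seen (Suc i) = insert (w ! i) (seen i)" if "i < n" for i
    using that len by (simp add: seen_def take_Suc_conv_app_nth)
  have rep_Suc: "rep (Suc i) = (if w ! i \<in> seen i then Suc (rep i) else rep i)" if "i < n" for i
    using seen_Suc[OF that] card_le[of i]
    by (auto simp: rep_def insert_absorb seen_def)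
  have rep_n: "rep n = n - k"
    using len set by (simp add: rep_def seen_def)
  have kn: "k \<le> n" using card_length[of w] len set by simp
  have rep_mono: "rep i \<le> rep j" if "i \<le> j" "j \<le> n" for i j
    using that
  proof (induction j rule: dec_induct)
    case (step m) then show ?case using rep_Suc[of m] by auto
  qed simp
  have rep_bound: "rep i < n - k" if "i < n" "w ! i \<in> seen i" for i
    using rep_mono[of "Suc i" n] rep_Suc[of i] that rep_n by auto
  have in_k: "w ! i \<in> {1..k}" if "i < n" for i
    using that len set nth_mem[of i w] by auto
  have nth_ss: "ss ! i = (if w ! i \<in> seen i then n - rep i else w ! i)" if "i < n" for i
    using that by (simp add: ss_def)
  have taken: "set (take i ss) = seen i \<union> {n - rep i<..n}" if "i \<le> n" for i
    using that
  proof (induction i)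
    case 0 show ?case by (auto simp: seen_def rep_def)
  next
    case (Suc i)
    then have "i < n" by simp
    have "set (take (Suc i) ss) = insert (ss ! i) (set (take i ss))"
      using \<open>i < n\<close> by (simp add: take_Suc_conv_app_nth ss_def)
    then show ?case
      using Suc rep_bound[OF \<open>i < n\<close>]
      by (auto simp: nth_ss rep_Suc seen_Suc)
  qed
  have "set ss = {1..n}"
  proof -
    have "length ss = n" by (simp add: ss_def)
    then have "set ss = {1..k} \<union> {k<..n}"
      using taken[of n] rep_n len set kn by (simp add: seen_def)
    also have "\<dots> = {1..n}" using kn by auto
    finally show ?thesis .
  qed
  moreover have "w ! i = ss ! i \<or>
      w ! i \<in> set (take i ss) \<and> w ! i < ss ! i \<and> {ss ! i<..n} \<subseteq> set (take i ss)" if "i < n" for i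
    using that nth_ss[of i] taken[of i] rep_bound[of i] in_k[of i] by auto
  ultimately have "outcome n w ss"
    using len by (auto simp: outcome_def ss_def)
  then show ?thesis ..
qed

lemma LS_eq_surjective_words: "LS n {1..k} = surjective_words n k"
proof -
  have "length as = n" if "outcome n as ss" for as ss
    using that by (simp add: outcome_def)
  then show ?thesis
    using surjective_word_outcome[of _ n k] lucky_spots_outcome[of n]
    by (fastforce simp: LS_def frustrated_iff_outcome surjective_words_def)
qed

section \<open>Counting surjective words\<close>

text \<open>
  A word is recorded by the list of its fibres, the \<open>j\<close>-th entry being the set of positions of the
  letter \<open>j\<close>. The lists that arise are the enumerations of the partitions into \<open>k\<close> blocks, and each
  such partition has \<open>k!\<close> enumerations.
\<close>

lemma card_surjective_words: "card (surjective_words n k) = fact k * stirling2 n k"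
proof -
  define part where "part = {P. partition_on {1..n} P \<and> card P = k}"
  define blocks where "blocks = (\<lambda>w::nat list. map (\<lambda>j. {p \<in> {1..n}. w ! (p - 1) = j}) [1..<Suc k])"
  have finP: "finite P" if "P \<in> part" for P
    using that finite_elements[of "{1..n}" P] by (auto simp: part_def)
  have fin: "finite part"
    by (rule finite_subset[of _ "Pow (Pow {1..n})"]) (auto simp: part_def partition_on_def)
  have nth_blocks: "blocks w ! i = {p \<in> {1..n}. w ! (p - 1) = Suc i}" if "i < k" for i w
    using that by (simp add: blocks_def del: upt_Suc)
  have len_blocks: "length (blocks w) = k" for w by (simp add: blocks_def)
  have inj: "inj_on blocks (surjective_words n k)"
  proof (rule inj_onI)
    fix v w assume vw: "v \<in> surjective_words n k" "w \<in> surjective_words n k" "blocks v = blocks w"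
    then have len: "length v = n" "length w = n" by (auto simp: surjective_words_def)
    show "v = w"
    proof (rule nth_equalityI)
      fix i assume "i < length v"
      then have i: "i < n" using len by simp
      then have "v ! i \<in> {1..k}" using vw(1) nth_mem[of i v] len by (auto simp: surjective_words_def)
      then obtain j where j: "v ! i = Suc j" "j < k" by (cases "v ! i") auto
      have "Suc i \<in> blocks v ! j" using i j nth_blocks by simp
      with vw(3) have "Suc i \<in> blocks w ! j" by simp
      with j nth_blocks[of j w] show "v ! i = w ! i" by simp
    qed (use len in simp)
  qed
  have img: "blocks ` surjective_words n k = (\<Union>P\<in>part. permutations_of_set P)"
  proof (intro equalityI subsetI)
    fix bs assume "bs \<in> blocks ` surjective_words n k"
    then obtain w where w: "length w = n" "set w = {1..k}" and bs: "bs = blocks w"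
      by (auto simp: surjective_words_def)
    have nonempty: "blocks w ! i \<noteq> {}" if i: "i < k" for i
    proof -
      have "Suc i \<in> set w" using i w by auto
      then obtain p where "p < n" "w ! p = Suc i" using w(1) by (metis in_set_conv_nth)
      then have "Suc p \<in> blocks w ! i" using i by (simp add: nth_blocks)
      then show ?thesis by blast
    qed
    have disj: "blocks w ! i \<inter> blocks w ! j = {}" if "i < k" "j < k" "i \<noteq> j" for i j
      using that by (auto simp: nth_blocks)
    have dist: "distinct bs"
      unfolding bs distinct_conv_nth len_blocks using nonempty disj by (metis Int_absorb)
    have "partition_on {1..n} (set bs)"
    proof (rule partition_onI)
      have cover: "\<exists>i<k. p \<in> blocks w ! i" if p: "p \<in> {1..n}" for p
      proof -
        have "w ! (p - 1) \<in> {1..k}" using w p nth_mem[of "p - 1" w] by auto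
        then show ?thesis using p by (intro exI[of _ "w ! (p - 1) - 1"]) (auto simp: nth_blocks)
      qed
      show "\<Union> (set bs) = {1..n}"
      proof
        show "\<Union> (set bs) \<subseteq> {1..n}" by (auto simp: bs blocks_def)
        show "{1..n} \<subseteq> \<Union> (set bs)"
          using cover len_blocks by (fastforce simp: bs in_set_conv_nth)
      qed
    next
      fix p q assume "p \<in> set bs" "q \<in> set bs" "p \<noteq> q"
      then show "disjnt p q"
        using disj len_blocks by (metis disjnt_def in_set_conv_nth bs)
    next
      show "{} \<notin> set bs" using nonempty len_blocks by (metis in_set_conv_nth bs)
    qed
    moreover have "card (set bs) = k" using dist by (simp add: distinct_card bs len_blocks)
    ultimately show "bs \<in> (\<Union>P\<in>part. permutations_of_set P)"
      using dist by (auto simp: part_def permutations_of_set_def)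
  next
    fix bs assume "bs \<in> (\<Union>P\<in>part. permutations_of_set P)"
    then have part: "partition_on {1..n} (set bs)" and dist: "distinct bs" and len: "length bs = k"
      by (auto simp: part_def permutations_of_set_def distinct_card)
    have ex: "\<exists>!i. i < k \<and> p \<in> bs ! i" if p: "p \<in> {1..n}" for p
    proof -
      obtain b where b: "b \<in> set bs" "p \<in> b"
        using part p by (metis UnionE partition_onD1)
      then obtain i where i: "i < k" "p \<in> bs ! i" by (metis in_set_conv_nth len)
      moreover have "j = i" if "j < k" "p \<in> bs ! j" for j
        using partition_onD2[OF part] dist len i that
        by (auto simp: disjoint_def) (metis IntI empty_iff nth_eq_iff_index_eq nth_mem)
      ultimately show ?thesis by blast
    qed
    define block where "block = (\<lambda>p. THE i. i < k \<and> p \<in> bs ! i)"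
    have block: "block p < k" "p \<in> bs ! block p" if "p \<in> {1..n}" for p
      using theI'[OF ex[OF that]] by (auto simp: block_def)
    have block_eq: "block p = i" if "p \<in> {1..n}" "i < k" "p \<in> bs ! i" for p i
      using ex[OF that(1)] block[OF that(1)] that by blast
    have sub: "bs ! i \<subseteq> {1..n}" if "i < k" for i
      using partition_onD1[OF part] that len by (metis Union_upper nth_mem)
    define w where "w = map (\<lambda>p. Suc (block p)) [1..<Suc n]"
    have nth_w: "w ! (p - 1) = Suc (block p)" if "p \<in> {1..n}" for p
      using that by (cases p) (auto simp: w_def simp del: upt_Suc)
    have "blocks w = bs"
    proof (rule nth_equalityI)
      fix i assume "i < length (blocks w)"
      then have i: "i < k" by (simp add: len_blocks)
      show "blocks w ! i = bs ! i"
      proof (intro set_eqI)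
        fix p show "p \<in> blocks w ! i \<longleftrightarrow> p \<in> bs ! i"
          using i sub[OF i] block[of p] block_eq[of p i] nth_w[of p]
          unfolding nth_blocks[OF i] mem_Collect_eq by (metis Suc_inject subsetD)
      qed
    qed (simp add: len len_blocks)
    moreover have "w \<in> surjective_words n k"
    proof -
      have "block ` {1..n} = {..<k}"
      proof (intro equalityI subsetI)
        fix i assume "i \<in> {..<k}"
        then have i: "i < k" by simp
        then have "bs ! i \<noteq> {}" using partition_onD3[OF part] len by (metis nth_mem)
        then obtain p where "p \<in> bs ! i" by blast
        then show "i \<in> block ` {1..n}" using sub[OF i] block_eq[of p i] i by blast
      qed (use block in auto)
      then have "Suc ` block ` {1..n} = {1..k}" by (simp add: image_Suc_lessThan)
      then show ?thesis
        by (auto simp: surjective_words_def w_def atLeastLessThanSuc_atLeastAtMost image_image simp del: upt_Suc)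
    qed
    ultimately show "bs \<in> blocks ` surjective_words n k" by blast
  qed
  have "card (surjective_words n k) = card (\<Union>P\<in>part. permutations_of_set P)"
    using card_image[OF inj] img by simp
  also have "\<dots> = (\<Sum>P\<in>part. card (permutations_of_set P))"
    using fin by (intro card_UN_disjoint) (auto dest: permutations_of_setD(1))
  also have "\<dots> = (\<Sum>P\<in>part. fact k)"
    using finP by (intro sum.cong) (auto simp: part_def)
  also have "\<dots> = fact k * stirling2 n k"
    by (simp add: part_def stirling2_def mult.commute)
  finally show ?thesis .
qed

section \<open>Lucky cars and surjective words\<close>

definition first_occ :: "nat list \<Rightarrow> nat \<Rightarrow> nat" where
  "first_occ w j = (LEAST p. p \<in> {1..length w} \<and> w ! (p - 1) = j)"

text \<open>
  The car \<open>j \<le> k\<close> parks at the first occurrence of the letter \<open>j\<close>; the cars after that take the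
  spots left over, from the largest down.
\<close>

definition spots_of_word :: "nat \<Rightarrow> nat list \<Rightarrow> nat list" where
  "spots_of_word k w =
     map (first_occ w) [1..<Suc k] @
     rev (sorted_list_of_set ({1..length w} - first_occ w ` {1..k}))"

definition prefs_of_word :: "nat \<Rightarrow> nat list \<Rightarrow> nat list" where
  "prefs_of_word k w = map (\<lambda>p. first_occ w (w ! (p - 1))) (spots_of_word k w)"

lemma first_occ_in:
  assumes "j \<in> set w"
  shows "first_occ w j \<in> {1..length w}" "w ! (first_occ w j - 1) = j"
proof -
  obtain i where "i < length w" "w ! i = j" using assms by (auto simp: in_set_conv_nth)
  then have "\<exists>p. p \<in> {1..length w} \<and> w ! (p - 1) = j" by (intro exI[of _ "Suc i"]) auto
  from LeastI_ex[OF this]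
  show "first_occ w j \<in> {1..length w}" "w ! (first_occ w j - 1) = j"
    by (simp_all add: first_occ_def)
qed

lemma first_occ_le: "p \<in> {1..length w} \<Longrightarrow> first_occ w (w ! (p - 1)) \<le> p"
  unfolding first_occ_def by (rule Least_le) simp

text \<open>
  A leftover spot is not the first occurrence of its letter, so that first occurrence is strictly
  smaller; moreover it is already occupied by one of the first \<open>k\<close> cars. This is exactly what an
  unlucky car needs.
\<close>

lemma outcome_of_word:
  assumes w: "w \<in> surjective_words n k"
  shows "outcome n (prefs_of_word k w) (spots_of_word k w)"
    and "\<And>i. i < n \<Longrightarrow> prefs_of_word k w ! i = spots_of_word k w ! i \<longleftrightarrow> i < k"
proof -
  have len: "length w = n" and set: "set w = {1..k}"
    using w by (auto simp: surjective_words_def)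
  define F where "F = first_occ w ` {1..k}"
  define fs where "fs = map (first_occ w) [1..<Suc k]"
  define ds where "ds = rev (sorted_list_of_set ({1..n} - F))"
  define ss where "ss = spots_of_word k w"
  define as where "as = prefs_of_word k w"
  have ss: "ss = fs @ ds"
    by (simp add: ss_def spots_of_word_def fs_def ds_def F_def len)
  have F: "F \<subseteq> {1..n}"
    using first_occ_in(1)[of _ w] set len by (auto simp: F_def)
  have inj: "inj_on (first_occ w) {1..k}"
    using first_occ_in(2)[of _ w] set by (metis inj_onI)
  have cardF: "card F = k" using card_image[OF inj] by (simp add: F_def)
  have len_fs: "length fs = k" by (simp add: fs_def)
  have "k \<le> n" using card_mono[OF _ F] cardF by simp
  then have len_ss: "length ss = n"
    using card_Diff_subset[OF finite_subset[OF F] F] cardF by (simp add: ss len_fs ds_def)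
  have set_fs: "set fs = F" by (auto simp: fs_def F_def)
  have set_ds: "set ds = {1..n} - F" by (simp add: ds_def)
  have set_ss: "set ss = {1..n}" using F by (auto simp: ss set_fs set_ds)
  have desc: "sorted_wrt (\<lambda>x y. y < x) ds"
    by (simp add: ds_def sorted_wrt_rev)
  have nth_as: "as ! i = first_occ w (w ! (ss ! i - 1))" if "i < n" for i
    using that len_ss by (simp add: as_def prefs_of_word_def ss_def)
  have lucky: "as ! i = ss ! i" if "i < k" for i
  proof -
    have "ss ! i = first_occ w (Suc i)"
      using that by (simp add: ss fs_def nth_append del: upt_Suc)
    then show ?thesis
      using that \<open>k \<le> n\<close> first_occ_in(2)[of "Suc i" w] set by (simp add: nth_as)
  qed
  have unlucky: "as ! i \<in> set (take i ss) \<and> as ! i < ss ! i \<and> {ss ! i<..n} \<subseteq> set (take i ss)"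
    if i: "k \<le> i" "i < n" for i
  proof (intro conjI subsetI)
    have p: "ss ! i \<in> {1..n}" using set_ss len_ss i nth_mem[of i ss] by auto
    have "ss ! i \<in> set ds"
      using i len_ss len_fs by (simp add: ss nth_append)
    then have "ss ! i \<notin> F" by (simp add: set_ds)
    have "w ! (ss ! i - 1) \<in> {1..k}" using p len set nth_mem[of "ss ! i - 1" w] by auto
    then have asF: "as ! i \<in> F" using nth_as[of i] i by (simp add: F_def)
    moreover have "F \<subseteq> set (take i ss)"
      using i len_fs by (auto simp: ss set_fs)
    ultimately show "as ! i \<in> set (take i ss)" by blast
    have "as ! i \<le> ss ! i" using first_occ_le[of "ss ! i" w] p len nth_as i by simp
    moreover have "as ! i \<noteq> ss ! i" using asF \<open>ss ! i \<notin> F\<close> by metis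
    ultimately show "as ! i < ss ! i" by simp
    fix q assume q: "q \<in> {ss ! i<..n}"
    then have "q \<in> set ss" using set_ss by auto
    then obtain j where j: "j < n" "q = ss ! j" using len_ss by (auto simp: in_set_conv_nth)
    have "ss ! j < ss ! i" if "i < j"
      using sorted_wrt_nth_less[OF desc, of "i - k" "j - k"] that i j len_ss len_fs
      by (simp add: ss nth_append)
    then have "j < i" using q j by (metis greaterThanAtMost_iff less_asym linorder_neqE_nat)
    then show "q \<in> set (take i ss)" using j len_ss i by (auto simp: in_set_conv_nth)
  qed
  have "length as = n" using len_ss by (simp add: as_def prefs_of_word_def ss_def)
  then show "outcome n (prefs_of_word k w) (spots_of_word k w)"
    using len_ss set_ss lucky unlucky unfolding outcome_def as_def ss_def by (meson not_le)
  fix i assume "i < n"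
  then show "prefs_of_word k w ! i = spots_of_word k w ! i \<longleftrightarrow> i < k"
    using lucky[of i] unlucky[of i] unfolding as_def ss_def by (metis less_irrefl not_le)
qed

lemma LC_iff_outcome:
  assumes "k \<le> n"
  shows "as \<in> LC n {1..k} \<longleftrightarrow> (\<exists>ss. outcome n as ss \<and> (\<forall>i<n. as ! i = ss ! i \<longleftrightarrow> i < k))"
proof -
  have "lucky_cars n as = {1..k} \<longleftrightarrow> (\<forall>i<n. as ! i = ss ! i \<longleftrightarrow> i < k)" if ss: "outcome n as ss" for ss
  proof
    assume L: "lucky_cars n as = {1..k}"
    show "\<forall>i<n. as ! i = ss ! i \<longleftrightarrow> i < k"
    proof (intro allI impI)
      fix i assume "i < n"
      then have "Suc i \<in> lucky_cars n as \<longleftrightarrow> as ! i = ss ! i"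
        using lucky_cars_outcome[OF ss] by auto
      with L show "as ! i = ss ! i \<longleftrightarrow> i < k" by auto
    qed
  next
    assume R: "\<forall>i<n. as ! i = ss ! i \<longleftrightarrow> i < k"
    have "j \<in> {1..n} \<and> as ! (j - 1) = ss ! (j - 1) \<longleftrightarrow> j \<in> {1..k}" for j
      using R[rule_format, of "j - 1"] assms by (cases j) auto
    then show "lucky_cars n as = {1..k}"
      unfolding lucky_cars_outcome[OF ss] set_eq_iff mem_Collect_eq by blast
  qed
  then show ?thesis
    by (auto simp: LC_def frustrated_iff_outcome)
qed

text \<open>
  An unlucky car leaves no free spot beyond its own, so all cars after it park at smaller spots.
  Hence the spots of the first \<open>k\<close> cars determine those of all others.
\<close>

lemma unlucky_tail_descending:
  assumes ss: "outcome n as ss" and unlucky: "\<And>i. k \<le> i \<Longrightarrow> i < n \<Longrightarrow> as ! i \<noteq> ss ! i"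
  shows "drop k ss = rev (sorted_list_of_set ({1..n} - set (take k ss)))"
proof -
  note dist = outcome_distinct[OF ss]
  have len: "length ss = n" and set: "set ss = {1..n}"
    using ss by (auto simp: outcome_def)
  have "ss ! j < ss ! i" if "k \<le> i" "i < j" "j < n" for i j
  proof (rule ccontr)
    assume "\<not> ss ! j < ss ! i"
    moreover have "ss ! j \<noteq> ss ! i" using dist that len by (simp add: nth_eq_iff_index_eq)
    moreover have "ss ! j \<le> n" using that len set nth_mem[of j ss] by auto
    ultimately have "ss ! j \<in> {ss ! i<..n}" by auto
    also have "\<dots> \<subseteq> set (take i ss)"
    proof -
      have "i < n" "as ! i \<noteq> ss ! i" using unlucky[of i] that by auto
      then show ?thesis using ss unfolding outcome_def by blast
    qed
    also have "\<dots> \<subseteq> set (take j ss)" using that by (simp add: set_take_subset_set_take)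
    finally show False using not_in_take[OF dist, of j] that len by simp
  qed
  then have "sorted_wrt (\<lambda>x y. y < x) (drop k ss)"
    using len by (auto simp: sorted_wrt_iff_nth_less)
  then have "sorted_wrt (<) (rev (drop k ss))"
    by (simp add: sorted_wrt_rev)
  then have "sorted_list_of_set (set (rev (drop k ss))) = rev (drop k ss)"
    by (intro sorted_list_of_set.idem_if_sorted_distinct)
       (simp_all add: strict_sorted_iff)
  moreover have "set (drop k ss) = {1..n} - set (take k ss)"
    using set_take_disj_set_drop_if_distinct[OF dist, of k k] set
    by (metis Diff_cancel Un_Diff Un_Diff_Int Un_commute append_take_drop_id inf_commute
        order_refl set_append sup_bot_left)
  ultimately show ?thesis by (metis rev_rev_ident set_rev)
qed

text \<open>
  Injectivity: the preferences determine the spots, and from these one reads off the first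
  occurrence of each letter and then the first occurrence of the letter at each position. For
  surjectivity, \<open>owner p + 1\<close> is the lucky car that occupies the spot preferred by the car parked at
  \<open>p\<close>; the word of these labels has the spot of the lucky car \<open>j\<close> as first occurrence of \<open>j\<close>, since
  a car never parks before the spot it prefers.
\<close>

lemma bij_betw_prefs_of_word:
  assumes "k \<le> n"
  shows "bij_betw (prefs_of_word k) (surjective_words n k) (LC n {1..k})"
proof (rule bij_betwI')
  fix v w assume v: "v \<in> surjective_words n k" and w: "w \<in> surjective_words n k"
  have len: "length v = n" "length w = n" and set: "set v = {1..k}" "set w = {1..k}"
    using v w by (auto simp: surjective_words_def)
  show "prefs_of_word k v = prefs_of_word k w \<longleftrightarrow> v = w"
  proof
    assume eq: "prefs_of_word k v = prefs_of_word k w"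
    then have spots: "spots_of_word k v = spots_of_word k w"
      using outcome_of_word(1)[OF v] outcome_of_word(1)[OF w] outcome_unique by metis
    then have "map (first_occ v) [1..<Suc k] = map (first_occ w) [1..<Suc k]"
      unfolding spots_of_word_def by (simp del: upt_Suc)
    then have first: "first_occ v j = first_occ w j" if "j \<in> {1..k}" for j
      using that by (auto simp del: upt_Suc)
    have all: "set (spots_of_word k w) = {1..n}"
      using outcome_of_word(1)[OF w] by (simp add: outcome_def)
    show "v = w"
    proof (rule nth_equalityI)
      fix i assume "i < length v"
      then have i: "Suc i \<in> set (spots_of_word k w)" and "i < n" using all len by auto
      have "first_occ v (v ! i) = first_occ w (w ! i)"
        using eq i unfolding prefs_of_word_def spots by (auto dest!: bspec[of _ _ "Suc i"])
      moreover have vi: "v ! i \<in> {1..k}" and wi: "w ! i \<in> {1..k}"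
        using \<open>i < n\<close> len set nth_mem by metis+
      ultimately have "first_occ w (v ! i) = first_occ w (w ! i)" using first by simp
      then show "v ! i = w ! i"
        using first_occ_in(2)[of _ w] vi wi set by metis
    qed (use len in simp)
  qed simp
next
  fix w assume "w \<in> surjective_words n k"
  from outcome_of_word[OF this] show "prefs_of_word k w \<in> LC n {1..k}"
    using LC_iff_outcome[OF assms] by blast
next
  fix as assume "as \<in> LC n {1..k}"
  then obtain ss where ss: "outcome n as ss"
    and lucky: "\<And>i. i < n \<Longrightarrow> as ! i = ss ! i \<longleftrightarrow> i < k"
    using LC_iff_outcome[OF assms] by blast
  note dist = outcome_distinct[OF ss]
  have len: "length ss = n" "length as = n" and set: "set ss = {1..n}"
    using ss by (auto simp: outcome_def)
  have nth_inj: "i = j" if "ss ! i = ss ! j" "i < n" "j < n" for i j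
    using that dist len by (simp add: nth_eq_iff_index_eq)
  have range: "ss ! i \<in> {1..n}" if "i < n" for i
    using that len set nth_mem by metis
  have "\<exists>j<k. \<exists>i<n. ss ! i = p \<and> as ! i = ss ! j" if "p \<in> {1..n}" for p
  proof -
    obtain i where i: "i < n" "ss ! i = p"
      using \<open>p \<in> {1..n}\<close> set len by (metis in_set_conv_nth)
    obtain j where "j \<le> i" "as ! j = ss ! j" "as ! i = ss ! j"
      using preference_in_lucky[OF ss i(1)] by blast
    then show ?thesis using i lucky[of j] by (metis le_less_trans)
  qed
  then obtain owner where owner:
    "\<And>p. p \<in> {1..n} \<Longrightarrow> owner p < k \<and> (\<exists>i<n. ss ! i = p \<and> as ! i = ss ! owner p)"
    by metis
  have owner_lt: "owner (ss ! i) < k" and as_owner: "as ! i = ss ! owner (ss ! i)" if "i < n" for i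
    using owner[OF range[OF that]] nth_inj that by metis+
  have owner_lucky: "owner (ss ! j) = j" if "j < k" for j
    using as_owner[of j] owner_lt[of j] lucky[of j] nth_inj that assms
    by (metis order_less_le_trans)
  define w where "w = map (\<lambda>p. Suc (owner p)) [1..<Suc n]"
  have nth_w: "w ! (p - 1) = Suc (owner p)" if "p \<in> {1..n}" for p
    using that by (cases p) (auto simp: w_def simp del: upt_Suc)
  have len_w: "length w = n" by (simp add: w_def)
  have first: "first_occ w (Suc j) = ss ! j" if "j < k" for j
    unfolding first_occ_def
  proof (rule Least_equality)
    show "ss ! j \<in> {1..length w} \<and> w ! (ss ! j - 1) = Suc j"
      using that assms range[of j] nth_w[of "ss ! j"] owner_lucky len_w by simp
  next
    fix p assume "p \<in> {1..length w} \<and> w ! (p - 1) = Suc j"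
    then have p: "p \<in> {1..n}" "owner p = j" using nth_w[of p] len_w by auto
    then obtain i where "i < n" "ss ! i = p" "as ! i = ss ! j" using owner by metis
    then show "ss ! j \<le> p" using ss by (auto simp: outcome_def)
  qed
  have "owner ` {1..n} = {..<k}"
  proof (intro equalityI subsetI)
    fix j assume "j \<in> {..<k}"
    then show "j \<in> owner ` {1..n}"
      using owner_lucky[of j] range[of j] assms by (metis imageI lessThan_iff order_less_le_trans)
  qed (use owner in auto)
  then have "Suc ` owner ` {1..n} = {1..k}" by (simp add: image_Suc_lessThan)
  then have w: "w \<in> surjective_words n k"
    using len_w by (simp add: surjective_words_def w_def atLeastLessThanSuc_atLeastAtMost
        image_image del: upt_Suc)
  have fs: "map (first_occ w) [1..<Suc k] = take k ss"
    by (rule nth_equalityI) (use len assms first in \<open>auto simp del: upt_Suc\<close>)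
  then have "first_occ w ` {1..k} = set (take k ss)"
    by (metis atLeastLessThanSuc_atLeastAtMost list.set_map set_upt)
  then have "spots_of_word k w = take k ss @ drop k ss"
    using unlucky_tail_descending[OF ss, of k] lucky fs len_w
    by (simp add: spots_of_word_def del: upt_Suc append_take_drop_id)
  then have "prefs_of_word k w = as"
    using len nth_w range first owner_lt as_owner
    by (auto simp: prefs_of_word_def intro!: nth_equalityI)
  with w show "\<exists>w\<in>surjective_words n k. as = prefs_of_word k w" by blast
qed

theorem proposition2p23:
  fixes n k :: nat
  assumes "1 \<le> k" and "k \<le> n"
  shows "card (LC n {1..k}) = fact k * stirling2 n k
       \<and> card (LS n {1..k}) = fact k * stirling2 n k"
  using bij_betw_same_card[OF bij_betw_prefs_of_word[OF \<open>k \<le> n\<close>]]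
    LS_eq_surjective_words[of n k] card_surjective_words[of n k]
  by metis

end
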